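(* Let $\alpha,\beta>0$ and $\lambda\in\mathbb{R}$. The partial derivative $\frac{\partial}{\partial\beta}\left(t^{\beta-1}E_{\alpha,\beta}(\lambda t^{\alpha})\right)$ is a convoluted form with kernel of logarithmic type: $$\frac{\partial}{\partial\beta}\left(t^{\beta-1}E_{\alpha,\beta}(\lambda t^{\alpha})\right)=\int_0^t\left(\ln(t-t_1)+\gamma_0\right)t_1^{\beta-2}\,E_{\alpha,\beta-1}(\lambda t_1^{\alpha})\,dt_1$$ for every $t\ge0$.
   Context: $E_{\alpha,\beta}(z)=\sum_{k=0}^{\infty}\frac{z^k}{\Gamma(\alpha k+\beta)}$ is the two-parametric Mittag-Leffler function ($1/\Gamma$ is taken to be $0$ at the poles of $\Gamma$). $\gamma_0$ is the Euler–Mascheroni constant.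
   Formalization: The formula is proved with an ordinary integral for β>1; for 0<β≤1, where that integral diverges or gives a wrong value (e.g. β=1, λ=0), the integral is read as its regularization: ln(t−t₁)+γ₀ minus its value at t₁=0, plus (ln t+γ₀)t^{β−1}E_{α,β}(λt^α). *)

theory Defs
  imports "HOL-Analysis.Analysis"
begin

text \<open>\<open>rGamma\<close> is the entire function \<open>1 / Gamma\<close>, equal to 0 at the poles of \<open>Gamma\<close>.\<close>

definition mittag_leffler :: "real \<Rightarrow> real \<Rightarrow> real \<Rightarrow> real" where
  "mittag_leffler \<alpha> \<beta> z = (\<Sum>k. z ^ k * rGamma (\<alpha> * real k + \<beta>))"

text \<open>
  For \<open>s = 0\<close> and \<open>\<beta> \<le> 1\<close> the power \<open>s powr (\<beta> - 1)\<close> is 0 by the convention \<open>0 powr x = 0\<close>;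
  in an integral over \<open>s\<close> this only affects a null set.
\<close>

definition ml_fun :: "real \<Rightarrow> real \<Rightarrow> real \<Rightarrow> real \<Rightarrow> real" where
  "ml_fun \<alpha> \<beta> c s = s powr (\<beta> - 1) * mittag_leffler \<alpha> \<beta> (c * s powr \<alpha>)"

definition log_kernel :: "real \<Rightarrow> real" where
  "log_kernel s = ln s + euler_mascheroni"

text \<open>
  The integral of \<open>\<phi>(s) * ml_fun \<alpha> (\<beta> - 1) c s\<close> over \<open>0 \<le> s \<le> t\<close>, where
  \<open>ml_fun \<alpha> (\<beta> - 1) c s = s powr (\<beta> - 2) * mittag_leffler \<alpha> (\<beta> - 1) (c * s powr \<alpha>)\<close>.
  For \<open>\<beta> > 1\<close> this is an ordinary integral, and since \<open>ml_fun \<alpha> (\<beta> - 1) c\<close> is the derivative of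
  \<open>ml_fun \<alpha> \<beta> c\<close>, which vanishes at 0, it equals the expression below.
  For \<open>0 < \<beta> < 1\<close> the factor behaves like \<open>s powr (\<beta> - 2)\<close> at 0 and the ordinary integral
  diverges when \<open>\<phi>(0) \<noteq> 0\<close>. The expression below is its canonical regularization, i.e. the
  analytic continuation in \<open>\<beta>\<close> of the integral: the factor stands for the distributional
  derivative of the locally integrable function \<open>ml_fun \<alpha> \<beta> c\<close> (extended by 0 to \<open>s < 0\<close>).
  In particular, at \<open>\<beta> = 1\<close> the \<open>k = 0\<close> term \<open>s powr (\<beta> - 2) * rGamma (\<beta> - 1)\<close> is the
  Dirac distribution at 0.
\<close>

definition ml_reg_integral ::
    "real \<Rightarrow> real \<Rightarrow> real \<Rightarrow> real \<Rightarrow> (real \<Rightarrow> real) \<Rightarrow> real" where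
  "ml_reg_integral \<alpha> \<beta> c t \<phi> =
     (LBINT s:{0..t}. (\<phi> s - \<phi> 0) * ml_fun \<alpha> (\<beta> - 1) c s) + \<phi> 0 * ml_fun \<alpha> \<beta> c t"

end

theory Submission imports Defs
begin

text \<open>
  Write \<open>\<gamma>\<close> for the Euler-Mascheroni constant and \<open>\<psi>\<close> for the Digamma function. In
  \<open>t powr (b - 1) * mittag_leffler \<alpha> b (c * t powr \<alpha>)\<close> the \<open>k\<close>-th term is
  \<open>c ^ k * t powr (p - 1) * rGamma p\<close> with \<open>p = \<alpha> * k + b\<close>, so both sides of the claim are series
  of elementary terms, and the claim follows term by term from one evaluation of an integral.

  On the one hand, the derivative of \<open>t powr (p - 1) * rGamma p\<close> in \<open>p\<close> is
  \<open>t powr (p - 1) * rGamma p * (ln t - \<psi>(p))\<close>. On the other hand, expanding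
  \<open>ln t - ln (t - s) = (\<Sum>n. (s / t) ^ (n + 1) / (n + 1))\<close> and integrating against
  \<open>s powr (p - 2)\<close> gives, for all \<open>p > 0\<close>,
  \<open>t powr (p - 1) * D p\<close>, where \<open>D p = (\<Sum>n. 1 / ((n + 1) * (p + n)))\<close>.
  The bridge between the two is the partial fraction series of the Digamma function, which says
  \<open>\<psi>(p) + \<gamma> = (p - 1) * D p\<close>. Together with \<open>rGamma (p - 1) = (p - 1) * rGamma p\<close> it turns the
  derivative into
  \<open>(ln t + \<gamma>) * t powr (p - 1) * rGamma p - rGamma (p - 1) * t powr (p - 1) * D p\<close>.
  The first summand is the boundary term of the regularized integral, and the second one the
  integral of \<open>(ln (t - s) - ln t) * s powr (p - 2) * rGamma (p - 1)\<close>. At \<open>p = 1\<close>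
  the latter integral is 0, in agreement with \<open>\<psi>(1) = -\<gamma>\<close>. For \<open>\<beta> > 1\<close> the constant \<open>ln t + \<gamma>\<close> can be moved
  back under the integral, since \<open>ml_fun \<alpha> (\<beta> - 1) c\<close> is then integrable with primitive
  \<open>ml_fun \<alpha> \<beta> c\<close>.

  Both interchanges with the series rest on two bounds: \<open>D\<close> is decreasing, hence bounded along the arguments
  \<open>p = \<alpha> * k + \<beta>\<close>, and \<open>rGamma x\<close> decays faster than every exponential
  (\<open>rGamma_le\<close>), which bounds the Mittag-Leffler series by a geometric one
  uniformly in \<open>b\<close> (\<open>mittag_leffler_majorant\<close>). The interchanges themselves are
  \<open>mittag_leffler_has_derivative\<close> and \<open>has_bochner_integral_weighted_ml_fun\<close>.
\<close>

section \<open>Uniform convergence of the Mittag-Leffler series\<close>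

text \<open>
  Keeping only the part of Euler's integral over \<open>{R..R+1}\<close> bounds \<open>Gamma x\<close> from below. Since
  \<open>R\<close> is arbitrary, this is superexponential decay.
\<close>

lemma rGamma_le:
  fixes R x :: real
  assumes "R \<ge> 1" "x \<ge> 1"
  shows "\<bar>rGamma x\<bar> \<le> exp (R + 1) * R powr (1 - x)"
proof -
  define f where "f = (\<lambda>s::real. s powr (x - 1) / exp s)"
  have f: "(f has_integral Gamma x) {0..}"
    unfolding f_def using assms by (intro Gamma_integral_real) auto
  have "((\<lambda>s. R powr (x - 1) / exp (R + 1)) has_integral
          ((R + 1) - R) *\<^sub>R (R powr (x - 1) / exp (R + 1))) {R..R+1}"
    using has_integral_const_real[of _ R "R+1"] by simp
  hence g: "((\<lambda>s. if s \<in> {R..R+1} then R powr (x - 1) / exp (R + 1) else 0)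
               has_integral R powr (x - 1) / exp (R + 1)) {0..}"
    using assms by (subst has_integral_restrict) auto
  have lower: "R powr (x - 1) / exp (R + 1) \<le> Gamma x"
  proof (rule has_integral_le[OF g f])
    fix s :: real assume "s \<in> {0..}"
    show "(if s \<in> {R..R+1} then R powr (x - 1) / exp (R + 1) else 0) \<le> f s"
      using assms by (auto simp: f_def intro!: frac_le powr_mono2)
  qed
  have pos: "0 < R powr (x - 1) / exp (R + 1)" using assms by simp
  have "\<bar>rGamma x\<bar> = inverse (Gamma x)"
    using lower pos by (simp add: rGamma_inverse_Gamma)
  also have "\<dots> \<le> inverse (R powr (x - 1) / exp (R + 1))"
    using lower pos by (intro le_imp_inverse_le)
  also have "\<dots> = exp (R + 1) * R powr (1 - x)"
    by (simp add: powr_diff field_simps)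
  finally show ?thesis .
qed

text \<open>
  The bound is uniform in \<open>b \<ge> -1\<close>: both \<open>b\<close> close to \<open>\<beta>\<close> and the shifted parameter \<open>b - 1\<close>, which
  may be negative, occur below. It is stated for large \<open>k\<close>, where \<open>\<alpha> * k + b \<ge> 1\<close> and the
  decay estimate applies.
\<close>
lemma mittag_leffler_majorant:
  fixes \<alpha> z :: real
  assumes "\<alpha> > 0"
  obtains M where "summable M"
    "\<forall>\<^sub>F k in sequentially. \<forall>b\<ge>-1. \<bar>z ^ k * rGamma (\<alpha> * real k + b)\<bar> \<le> M k"
proof -
  \<comment> \<open>The radius is chosen such that \<open>\<bar>z\<bar> / R powr \<alpha> \<le> 1 / 2\<close>.\<close>
  define R where "R = (2 * \<bar>z\<bar> + 1) powr (1 / \<alpha>)"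
  have R: "R \<ge> 1" unfolding R_def using assms by (intro ge_one_powr_ge_zero) auto
  have R\<alpha>: "R powr \<alpha> = 2 * \<bar>z\<bar> + 1"
    using assms by (simp add: R_def powr_powr)
  define M where "M = (\<lambda>k::nat. exp (R + 1) * R\<^sup>2 * (1/2) ^ k)"
  have "\<forall>\<^sub>F k in sequentially. \<alpha> * real k \<ge> 2"
    using assms by real_asymp
  hence "\<forall>\<^sub>F k in sequentially. \<forall>b\<ge>-1. \<bar>z ^ k * rGamma (\<alpha> * real k + b)\<bar> \<le> M k"
  proof (eventually_elim, intro allI impI)
    fix k :: nat and b :: real
    assume k: "\<alpha> * real k \<ge> 2" and b: "b \<ge> -1"
    have "\<bar>rGamma (\<alpha> * real k + b)\<bar> \<le> exp (R + 1) * R powr (1 - (\<alpha> * real k + b))"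
      using R k b by (intro rGamma_le) auto
    also have "\<dots> \<le> exp (R + 1) * R powr (2 - \<alpha> * real k)"
      using R b by (intro mult_left_mono powr_mono) auto
    also have "R powr (2 - \<alpha> * real k) = R\<^sup>2 / (2 * \<bar>z\<bar> + 1) ^ k"
    proof -
      have "R powr (\<alpha> * real k) = (2 * \<bar>z\<bar> + 1) ^ k"
        using R by (simp flip: R\<alpha> powr_powr add: powr_realpow)
      thus ?thesis using R by (simp add: powr_diff)
    qed
    finally have "\<bar>z\<bar> ^ k * \<bar>rGamma (\<alpha> * real k + b)\<bar>
        \<le> \<bar>z\<bar> ^ k * (exp (R + 1) * (R\<^sup>2 / (2 * \<bar>z\<bar> + 1) ^ k))"
      by (intro mult_left_mono) auto
    also have "\<dots> = exp (R + 1) * R\<^sup>2 * (\<bar>z\<bar> / (2 * \<bar>z\<bar> + 1)) ^ k"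
      by (simp add: power_divide)
    also have "\<dots> \<le> M k"
      unfolding M_def by (intro mult_left_mono power_mono) (auto simp: field_simps)
    finally show "\<bar>z ^ k * rGamma (\<alpha> * real k + b)\<bar> \<le> M k"
      by (simp add: abs_mult power_abs)
  qed
  moreover have "summable M"
    unfolding M_def by (intro summable_mult summable_geometric) auto
  ultimately show ?thesis using that by blast
qed

lemma summable_mittag_leffler:
  fixes \<alpha> b z :: real
  assumes "\<alpha> > 0" "b \<ge> -1"
  shows "summable (\<lambda>k. \<bar>z ^ k * rGamma (\<alpha> * real k + b)\<bar>)"
proof -
  obtain M where M: "summable M"
    "\<forall>\<^sub>F k in sequentially. \<forall>b\<ge>-1. \<bar>z ^ k * rGamma (\<alpha> * real k + b)\<bar> \<le> M k"
    using mittag_leffler_majorant[OF assms(1)] by blast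
  show ?thesis
  proof (rule summable_comparison_test_ev[OF _ M(1)])
    show "\<forall>\<^sub>F k in sequentially. norm \<bar>z ^ k * rGamma (\<alpha> * real k + b)\<bar> \<le> M k"
      using M(2) by eventually_elim (use assms in auto)
  qed
qed

section \<open>The quotient of the Digamma function and the derivative in the second parameter\<close>

text \<open>
  This is \<open>(Digamma p + euler_mascheroni) / (p - 1)\<close> with the removable singularity at \<open>p = 1\<close>
  filled in. The series form makes positivity and monotonicity evident.
\<close>
definition digamma_quotient :: "real \<Rightarrow> real" where
  "digamma_quotient p = (\<Sum>n. 1 / (real (Suc n) * (p + real n)))"

lemma summable_digamma_quotient:
  fixes p :: real
  assumes "p > 0"
  shows "summable (\<lambda>n. 1 / (real (Suc n) * (p + real n)))"
proof (rule summable_comparison_test_ev)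
  show "summable (\<lambda>n. 1 / real n ^ 2)" by (rule inverse_power_summable[of 2, where 'a=real, unfolded inverse_eq_divide]) auto
  show "\<forall>\<^sub>F n in sequentially. norm (1 / (real (Suc n) * (p + real n))) \<le> 1 / real n ^ 2"
    using eventually_gt_at_top[of 0]
  proof eventually_elim
    case (elim n)
    have "1 / (real (Suc n) * (p + real n)) \<le> 1 / (real n * real n)"
      using assms elim by (intro divide_left_mono mult_mono) auto
    thus ?case using assms by (simp add: power2_eq_square)
  qed
qed

lemma digamma_quotient_nonneg: "p > 0 \<Longrightarrow> digamma_quotient p \<ge> 0"
  unfolding digamma_quotient_def by (intro suminf_nonneg summable_digamma_quotient) auto

lemma digamma_quotient_antimono:
  assumes "0 < p" "p \<le> q"
  shows "digamma_quotient q \<le> digamma_quotient p"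
  unfolding digamma_quotient_def using assms
  by (intro suminf_le summable_digamma_quotient divide_left_mono mult_left_mono) auto

lemma Digamma_eq_digamma_quotient:
  assumes "p > 0"
  shows "Digamma p + euler_mascheroni = (p - 1) * digamma_quotient p"
proof -
  have "Digamma p + euler_mascheroni = (\<Sum>n. inverse (real (Suc n)) - inverse (p + real n))"
    by (simp add: Digamma_def)
  also have "\<dots> = (\<Sum>n. (p - 1) * (1 / (real (Suc n) * (p + real n))))"
    using assms by (intro suminf_cong) (simp add: field_simps)
  also have "\<dots> = (p - 1) * digamma_quotient p"
    unfolding digamma_quotient_def by (rule suminf_mult[OF summable_digamma_quotient[OF assms]])
  finally show ?thesis .
qed

text \<open>
  Trading \<open>Digamma p * rGamma p\<close> for \<open>rGamma (p - 1)\<close> replaces the Digamma factor, which grows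
  with \<open>p\<close>, by a decreasing one and produces the coefficient that occurs in \<open>ml_fun \<alpha> (\<beta> - 1)\<close>.
\<close>
lemma rGamma_has_derivative_digamma_quotient:
  assumes "p > 0"
  shows "(rGamma has_real_derivative
            euler_mascheroni * rGamma p - digamma_quotient p * rGamma (p - 1)) (at p within S)"
proof -
  have "p \<notin> \<int>\<^sub>\<le>\<^sub>0" using assms by (auto elim!: nonpos_Ints_cases)
  hence "(rGamma has_real_derivative - rGamma p * Digamma p) (at p within S)"
    by (rule has_field_derivative_rGamma_no_nonpos_int)
  moreover have "rGamma (p - 1) = (p - 1) * rGamma p"
    using rGamma_plus1[of "p - 1"] by simp
  moreover have "Digamma p = (p - 1) * digamma_quotient p - euler_mascheroni"
    using Digamma_eq_digamma_quotient[OF assms] by simp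
  ultimately show ?thesis
    by (simp only: \<open>rGamma (p - 1) = _\<close>) (simp add: algebra_simps)
qed

text \<open>
  Term by term differentiation is justified on \<open>{\<beta>/2..}\<close>: there \<open>digamma_quotient\<close> is bounded by its
  value at \<open>\<beta>/2\<close>, so that the series of derivatives is dominated by the majorant above.
\<close>
lemma mittag_leffler_has_derivative:
  fixes \<alpha> \<beta> z :: real
  assumes "\<alpha> > 0" "\<beta> > 0"
  shows "((\<lambda>b. mittag_leffler \<alpha> b z) has_real_derivative
            euler_mascheroni * mittag_leffler \<alpha> \<beta> z -
            (\<Sum>k. z ^ k * rGamma (\<alpha> * real k + \<beta> - 1) * digamma_quotient (\<alpha> * real k + \<beta>)))
          (at \<beta>)"
proof -
  define h where "h = (\<lambda>k b. z ^ k * (euler_mascheroni * rGamma (\<alpha> * real k + b) -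
      digamma_quotient (\<alpha> * real k + b) * rGamma (\<alpha> * real k + b - 1)))"
  obtain M where M: "summable M"
    "\<forall>\<^sub>F k in sequentially. \<forall>b\<ge>-1. \<bar>z ^ k * rGamma (\<alpha> * real k + b)\<bar> \<le> M k"
    using mittag_leffler_majorant[OF assms(1)] by blast
  define C where "C = digamma_quotient (\<beta> / 2)"
  have DC: "0 \<le> digamma_quotient (\<alpha> * real k + b)" "digamma_quotient (\<alpha> * real k + b) \<le> C"
    if "b \<ge> \<beta> / 2" for k b
    using assms that unfolding C_def
    by (auto intro!: digamma_quotient_nonneg digamma_quotient_antimono add_nonneg_pos simp: add_increasing)
  have unif: "uniformly_convergent_on {\<beta>/2..} (\<lambda>n b. \<Sum>k<n. h k b)"
  proof (rule Weierstrass_m_test'_ev)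
    show "summable (\<lambda>k. (euler_mascheroni + C) * M k)" by (rule summable_mult[OF M(1)])
    show "\<forall>\<^sub>F k in sequentially. \<forall>b\<in>{\<beta>/2..}. norm (h k b) \<le> (euler_mascheroni + C) * M k"
      using M(2)
    proof (eventually_elim, intro ballI)
      fix k :: nat and b :: real
      assume M': "\<forall>b\<ge>-1. \<bar>z ^ k * rGamma (\<alpha> * real k + b)\<bar> \<le> M k" and b: "b \<in> {\<beta>/2..}"
      define u where "u = z ^ k * rGamma (\<alpha> * real k + b)"
      define v where "v = z ^ k * rGamma (\<alpha> * real k + b - 1)"
      have u: "\<bar>u\<bar> \<le> M k" using M'[rule_format, of b] b assms by (simp add: u_def)
      have v: "\<bar>v\<bar> \<le> M k" using M'[rule_format, of "b - 1"] b assms by (simp add: v_def add_diff_eq)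
      have "h k b = euler_mascheroni * u - digamma_quotient (\<alpha> * real k + b) * v"
        by (simp add: h_def u_def v_def algebra_simps)
      also have "norm \<dots> \<le> \<bar>euler_mascheroni * u\<bar> + \<bar>digamma_quotient (\<alpha> * real k + b) * v\<bar>"
        by simp
      also have "\<dots> \<le> euler_mascheroni * M k + C * M k"
        using u v DC[of b k] b euler_mascheroni_pos unfolding abs_mult
        by (intro add_mono mult_mono) auto
      finally show "norm (h k b) \<le> (euler_mascheroni + C) * M k" by (simp add: algebra_simps)
    qed
  qed
  have "((\<lambda>b. \<Sum>k. z ^ k * rGamma (\<alpha> * real k + b)) has_real_derivative (\<Sum>k. h k \<beta>)) (at \<beta>)"
  proof (rule has_field_derivative_series'(2)[OF _ _ unif])
    show "((\<lambda>b. z ^ k * rGamma (\<alpha> * real k + b)) has_real_derivative h k b) (at b within {\<beta>/2..})"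
      if "b \<in> {\<beta>/2..}" for k b
    proof -
      have "\<alpha> * real k + b > 0" using assms that by (intro add_nonneg_pos) auto
      note rGamma_has_derivative_digamma_quotient[OF this, of UNIV]
      moreover have "((\<lambda>b. \<alpha> * real k + b) has_real_derivative 1) (at b within {\<beta>/2..})"
        by (auto intro!: derivative_eq_intros)
      ultimately have "((\<lambda>b. rGamma (\<alpha> * real k + b)) has_real_derivative
          (euler_mascheroni * rGamma (\<alpha> * real k + b) -
           digamma_quotient (\<alpha> * real k + b) * rGamma (\<alpha> * real k + b - 1)) * 1)
          (at b within {\<beta>/2..})"
        by (rule DERIV_chain2[where f = rGamma and g = "\<lambda>b. \<alpha> * real k + b"])
      thus ?thesis unfolding h_def by (intro DERIV_cmult) simp
    qed
    show "summable (\<lambda>k. z ^ k * rGamma (\<alpha> * real k + \<beta>))"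
      using assms by (intro summable_rabs_cancel[OF summable_mittag_leffler]) auto
  qed (use assms in \<open>auto simp: interior_real_atLeast\<close>)
  moreover have "(\<Sum>k. h k \<beta>) = euler_mascheroni * mittag_leffler \<alpha> \<beta> z -
      (\<Sum>k. z ^ k * rGamma (\<alpha> * real k + \<beta> - 1) * digamma_quotient (\<alpha> * real k + \<beta>))"
  proof -
    have s1: "summable (\<lambda>k. z ^ k * rGamma (\<alpha> * real k + \<beta>))"
      using assms by (intro summable_rabs_cancel[OF summable_mittag_leffler]) auto
    have s2: "summable (\<lambda>k. z ^ k * rGamma (\<alpha> * real k + \<beta> - 1) * digamma_quotient (\<alpha> * real k + \<beta>))"
    proof (rule summable_comparison_test')
      show "summable (\<lambda>k. \<bar>z ^ k * rGamma (\<alpha> * real k + (\<beta> - 1))\<bar> * C)"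
        using assms by (intro summable_mult2 summable_mittag_leffler) auto
      show "norm (z ^ k * rGamma (\<alpha> * real k + \<beta> - 1) * digamma_quotient (\<alpha> * real k + \<beta>))
          \<le> \<bar>z ^ k * rGamma (\<alpha> * real k + (\<beta> - 1))\<bar> * C" if "k \<ge> 0" for k
        using DC[of \<beta> k] assms by (auto simp: abs_mult add_diff_eq intro!: mult_left_mono)
    qed
    show ?thesis
      unfolding mittag_leffler_def suminf_mult[OF s1, symmetric]
      by (subst suminf_diff[OF summable_mult[OF s1] s2])
         (auto simp: h_def algebra_simps)
  qed
  ultimately show ?thesis by (simp add: mittag_leffler_def)
qed

section \<open>Moments of the logarithmic kernel\<close>

text \<open>
  At the endpoint \<open>s = t\<close> the kernel \<open>ln (t - s)\<close> takes the meaningless value \<open>ln 0 = 0\<close>, which spoils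
  the series expansion and the sign of \<open>ln t - ln (t - s)\<close>. The integrals are therefore
  evaluated over the half-open interval.
\<close>
lemma has_bochner_integral_half_open_iff:
  fixes f :: "real \<Rightarrow> real"
  shows "has_bochner_integral lborel (\<lambda>s. indicator {0..<t} s * f s) x \<longleftrightarrow>
         has_bochner_integral lborel (\<lambda>s. indicator {0..t} s * f s) x"
  by (rule has_bochner_integral_discrete_difference[of "{t}"]) (auto simp: indicator_def)

lemma has_bochner_integral_powr:
  fixes a t :: real
  assumes "a > -1" "t > 0"
  shows "has_bochner_integral lborel (\<lambda>s. indicator {0..<t} s * s powr a) (t powr (a + 1) / (a + 1))"
  unfolding has_bochner_integral_half_open_iff
proof (rule has_bochner_integral_nn_integral)
  show "(\<integral>\<^sup>+ s. ennreal (indicator {0..t} s * s powr a) \<partial>lborel) = ennreal (t powr (a + 1) / (a + 1))"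
    using assms by (intro nn_integral_has_integral_lebesgue has_integral_powr_from_0) auto
qed (use assms in \<open>auto simp: indicator_def\<close>)

text \<open>
  Near \<open>s = 0\<close> the weight \<open>ln t - ln (t - s)\<close> vanishes to first order, which is why \<open>p > 0\<close> suffices
  although \<open>s powr (p - 2)\<close> alone requires \<open>p > 1\<close>. In the power series of the weight each term
  raises the exponent by at least one, and all terms are nonnegative, so that the sum may be
  integrated term by term.
\<close>
lemma has_bochner_integral_log_moment:
  fixes p t :: real
  assumes "p > 0" "t > 0"
  shows "has_bochner_integral lborel
           (\<lambda>s. indicator {0..<t} s * ((ln t - ln (t - s)) * s powr (p - 2)))
           (t powr (p - 1) * digamma_quotient p)"
proof -
  define f where "f = (\<lambda>n s. (1 / (real (Suc n) * t ^ Suc n)) *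
     (indicator {0..<t} s * s powr (real n + p - 1)))"
  have int: "has_bochner_integral lborel (f n)
               (t powr (p - 1) * (1 / (real (Suc n) * (p + real n))))" for n
  proof -
    have "has_bochner_integral lborel (f n)
      (1 / (real (Suc n) * t ^ Suc n) * (t powr (real n + p - 1 + 1) / (real n + p - 1 + 1)))"
      unfolding f_def using assms
      by (intro has_bochner_integral_mult_right has_bochner_integral_powr) auto
    moreover have "t powr (real n + p - 1 + 1) = t powr (p - 1) * t ^ Suc n"
    proof -
      have "t powr (real n + p - 1 + 1) = t powr ((p - 1) + real (Suc n))"
        by (simp add: algebra_simps)
      also have "\<dots> = t powr (p - 1) * t ^ Suc n"
        using assms by (simp only: powr_add powr_realpow)
      finally show ?thesis .
    qed
    moreover have "1 / (real (Suc n) * t ^ Suc n) * (t powr (p - 1) * t ^ Suc n / (real n + p - 1 + 1)) =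
        t powr (p - 1) * (1 / (real (Suc n) * (p + real n)))"
      using assms by (simp add: add.commute del: power_Suc of_nat_Suc)
    ultimately show ?thesis by (simp only:)
  qed
  have nonneg: "f n s \<ge> 0" for n s using assms by (auto simp: f_def indicator_def)
  have sums: "(\<lambda>n. f n s) sums (indicator {0..<t} s * ((ln t - ln (t - s)) * s powr (p - 2)))" for s
  proof (cases "0 < s \<and> s < t")
    case True
    have "(\<lambda>n. - ((- (- (s / t))) ^ n) / real n) sums ln (1 + - (s / t))"
      using True by (intro ln_series') auto
    hence "(\<lambda>n. - ((s / t) ^ Suc n) / real (Suc n)) sums ln (1 - s / t)"
      by (subst sums_Suc_iff) simp
    moreover have "ln (1 - s / t) = ln (t - s) - ln t"
      using True ln_div[of "t - s" t] by (simp add: diff_divide_distrib)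
    ultimately have "(\<lambda>n. (s / t) ^ Suc n / real (Suc n)) sums (ln t - ln (t - s))"
      using sums_minus by fastforce
    hence "(\<lambda>n. (s / t) ^ Suc n / real (Suc n) * s powr (p - 2)) sums
             ((ln t - ln (t - s)) * s powr (p - 2))"
      by (rule sums_mult2)
    moreover have "(s / t) ^ Suc n / real (Suc n) * s powr (p - 2) = f n s" for n
    proof -
      have "s powr (real n + p - 1) = s ^ Suc n * s powr (p - 2)"
      proof -
        have "s powr (real n + p - 1) = s powr (real (Suc n) + (p - 2))"
          by (simp add: algebra_simps)
        also have "\<dots> = s ^ Suc n * s powr (p - 2)"
          using True by (simp only: powr_add powr_realpow)
        finally show ?thesis .
      qed
      thus ?thesis using True by (simp add: f_def power_divide del: power_Suc)
    qed
    ultimately show ?thesis using True by simp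
  next
    case False
    hence "f n s = 0" for n by (auto simp: f_def indicator_def)
    moreover have "indicator {0..<t} s * ((ln t - ln (t - s)) * s powr (p - 2)) = 0"
      using False by (auto simp: indicator_def)
    ultimately show ?thesis by (simp only: sums_zero)
  qed
  have integrable: "integrable lborel (f n)" for n
    using int unfolding has_bochner_integral_iff by blast
  have eq: "integral\<^sup>L lborel (f n) = t powr (p - 1) * (1 / (real (Suc n) * (p + real n)))" for n
    using int unfolding has_bochner_integral_iff by blast
  have AE: "AE s in lborel. summable (\<lambda>n. norm (f n s))"
    using sums nonneg by (auto simp: sums_iff)
  have summ: "summable (\<lambda>n. \<integral>s. norm (f n s) \<partial>lborel)"
    using nonneg summable_mult[OF summable_digamma_quotient[OF assms(1)]] by (simp add: eq)
  have fun_eq: "(\<lambda>s. \<Sum>n. f n s) = (\<lambda>s. indicator {0..<t} s * ((ln t - ln (t - s)) * s powr (p - 2)))"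
    using sums by (auto simp: sums_iff)
  have "(\<Sum>n. integral\<^sup>L lborel (f n)) = t powr (p - 1) * digamma_quotient p"
    unfolding eq digamma_quotient_def by (rule suminf_mult[OF summable_digamma_quotient[OF assms(1)]])
  with integrable_suminf[OF integrable AE summ] integral_suminf[OF integrable AE summ]
  show ?thesis by (simp add: has_bochner_integral_iff fun_eq)
qed

section \<open>Integrating the Mittag-Leffler function against a weight\<close>

text \<open>
  Because the weight \<open>w\<close> is nonnegative, the integral of the absolute value of each term is the
  absolute value of its integral, and boundedness of the normalized moments \<open>m\<close> makes these summable.
  The constant weight and the logarithmic weight are the two instances of interest.
\<close>
lemma has_bochner_integral_weighted_ml_fun:
  fixes \<alpha> \<beta> c t C :: real and w m :: "real \<Rightarrow> real"
  assumes "\<alpha> > 0" "\<beta> \<ge> 0" "t > 0"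
    and moment: "\<And>p. p \<ge> \<beta> \<Longrightarrow>
      has_bochner_integral lborel (\<lambda>s. indicator {0..<t} s * (w s * s powr (p - 2))) (t powr (p - 1) * m p)"
    and bound: "\<And>p. p \<ge> \<beta> \<Longrightarrow> \<bar>m p\<bar> \<le> C"
    and nonneg: "\<And>s. 0 \<le> s \<Longrightarrow> s < t \<Longrightarrow> w s \<ge> 0"
  shows "has_bochner_integral lborel (\<lambda>s. indicator {0..<t} s * (w s * ml_fun \<alpha> (\<beta> - 1) c s))
    (t powr (\<beta> - 1) *
       (\<Sum>k. (c * t powr \<alpha>) ^ k * rGamma (\<alpha> * real k + \<beta> - 1) * m (\<alpha> * real k + \<beta>)))"
proof -
  define p where "p = (\<lambda>k. \<alpha> * real k + \<beta>)"
  define a where "a = (\<lambda>k. c ^ k * rGamma (p k - 1))"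
  define g where "g = (\<lambda>k s. indicator {0..<t} s * (w s * s powr (p k - 2)))"
  define I where "I = (\<lambda>k. t powr (p k - 1) * m (p k))"
  have p: "p k \<ge> \<beta>" for k using assms by (simp add: p_def)
  have powr_split: "c ^ k * s powr (p k + d) = s powr (\<beta> + d) * (c * s powr \<alpha>) ^ k"
    if "s > 0" for s d k
  proof -
    have "s powr (p k + d) = s powr (\<beta> + d) * (s powr \<alpha>) ^ k"
      using that by (simp add: p_def powr_powr flip: powr_realpow powr_add) (simp add: algebra_simps)
    thus ?thesis by (simp add: power_mult_distrib)
  qed
  have ml_abs: "summable (\<lambda>k. \<bar>(c * s powr \<alpha>) ^ k * rGamma (p k - 1)\<bar>)" for s
    using summable_mittag_leffler[of \<alpha> "\<beta> - 1"] assms by (simp add: p_def add_diff_eq)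
  have g: "has_bochner_integral lborel (g k) (I k)" for k
    unfolding g_def I_def by (rule moment[OF p])
  have g_nonneg: "g k s \<ge> 0" for k s
    using nonneg by (auto simp: g_def indicator_def)
  have I: "a k * I k = t powr (\<beta> - 1) * ((c * t powr \<alpha>) ^ k * rGamma (p k - 1) * m (p k))" for k
    using powr_split[of t k "-1"] assms by (simp add: a_def I_def mult_ac)
  have termwise: "a k * g k s = indicator {0..<t} s * w s * s powr (\<beta> - 2) *
               ((c * s powr \<alpha>) ^ k * rGamma (p k - 1))" for k s
  proof (cases "s > 0")
    case True
    thus ?thesis using powr_split[OF True, of k "-2"] by (simp add: a_def g_def mult_ac)
  qed (auto simp: g_def indicator_def)
  have integrable: "integrable lborel (\<lambda>s. a k * g k s)" for k
    using g by (intro integrable_mult_right) (auto simp: has_bochner_integral_iff)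
  have AE: "AE s in lborel. summable (\<lambda>k. norm (a k * g k s))"
    unfolding termwise real_norm_def abs_mult[of "indicator {0..<t} _ * w _ * _ powr _"]
    by (intro AE_I2 summable_mult ml_abs)
  have norm: "(\<integral>s. norm (a k * g k s) \<partial>lborel) = \<bar>a k * I k\<bar>" for k
  proof -
    have "0 \<le> integral\<^sup>L lborel (g k)"
      by (intro Bochner_Integration.integral_nonneg g_nonneg)
    hence "I k \<ge> 0" using g[of k] by (simp only: has_bochner_integral_iff)
    have "(\<integral>s. norm (a k * g k s) \<partial>lborel) = (\<integral>s. \<bar>a k\<bar> * g k s \<partial>lborel)"
      using g_nonneg by (intro Bochner_Integration.integral_cong) (auto simp: abs_mult)
    also have "\<dots> = \<bar>a k\<bar> * I k"
      using g[of k] by (simp add: has_bochner_integral_iff)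
    also have "\<dots> = \<bar>a k * I k\<bar>" using \<open>I k \<ge> 0\<close> by (simp add: abs_mult)
    finally show ?thesis .
  qed
  have summ_I: "summable (\<lambda>k. \<bar>a k * I k\<bar>)"
  proof (rule summable_comparison_test')
    show "summable (\<lambda>k. t powr (\<beta> - 1) * (\<bar>(c * t powr \<alpha>) ^ k * rGamma (p k - 1)\<bar> * C))"
      by (intro summable_mult summable_mult2 ml_abs)
    show "norm \<bar>a k * I k\<bar> \<le> t powr (\<beta> - 1) * (\<bar>(c * t powr \<alpha>) ^ k * rGamma (p k - 1)\<bar> * C)"
      if "k \<ge> 0" for k
      unfolding I using bound[OF p, of k] by (auto simp: abs_mult intro!: mult_left_mono)
  qed
  hence summ_norm: "summable (\<lambda>k. \<integral>s. norm (a k * g k s) \<partial>lborel)"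
    by (simp only: norm)
  have fun_eq: "(\<lambda>s. \<Sum>k. a k * g k s) = (\<lambda>s. indicator {0..<t} s * (w s * ml_fun \<alpha> (\<beta> - 1) c s))"
  proof
    fix s
    have "(\<Sum>k. a k * g k s) = indicator {0..<t} s * w s * s powr (\<beta> - 2) *
            (\<Sum>k. (c * s powr \<alpha>) ^ k * rGamma (p k - 1))"
      unfolding termwise by (intro suminf_mult summable_rabs_cancel[OF ml_abs])
    thus "(\<Sum>k. a k * g k s) = indicator {0..<t} s * (w s * ml_fun \<alpha> (\<beta> - 1) c s)"
      by (simp add: ml_fun_def mittag_leffler_def p_def add_diff_eq)
  qed
  have "(\<Sum>k. integral\<^sup>L lborel (\<lambda>s. a k * g k s)) = (\<Sum>k. a k * I k)"
    using g by (simp add: has_bochner_integral_iff)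
  also have "\<dots> = t powr (\<beta> - 1) * (\<Sum>k. (c * t powr \<alpha>) ^ k * rGamma (p k - 1) * m (p k))"
  proof -
    have "summable (\<lambda>k. (c * t powr \<alpha>) ^ k * rGamma (p k - 1) * m (p k))"
      using summable_rabs_cancel[OF summ_I] assms unfolding I by (simp add: summable_cmult_iff)
    thus ?thesis unfolding I by (rule suminf_mult)
  qed
  finally show ?thesis
    using integrable_suminf[OF integrable AE summ_norm] integral_suminf[OF integrable AE summ_norm]
    by (simp add: has_bochner_integral_iff fun_eq) (simp add: p_def)
qed

text \<open>
  With the constant weight the moments are \<open>1 / (p - 1)\<close>, and
  \<open>rGamma (p - 1) / (p - 1) = rGamma p\<close> raises the second parameter by one.
\<close>
lemma has_bochner_integral_ml_fun:
  assumes "\<alpha> > 0" "\<beta> > 1" "t > 0"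
  shows "has_bochner_integral lborel (\<lambda>s. indicator {0..<t} s * ml_fun \<alpha> (\<beta> - 1) c s) (ml_fun \<alpha> \<beta> c t)"
proof -
  have "has_bochner_integral lborel (\<lambda>s. indicator {0..<t} s * (1 * ml_fun \<alpha> (\<beta> - 1) c s))
    (t powr (\<beta> - 1) *
       (\<Sum>k. (c * t powr \<alpha>) ^ k * rGamma (\<alpha> * real k + \<beta> - 1) * (1 / (\<alpha> * real k + \<beta> - 1))))"
  proof (rule has_bochner_integral_weighted_ml_fun[where m = "\<lambda>p. 1 / (p - 1)" and C = "1 / (\<beta> - 1)"])
    show "has_bochner_integral lborel (\<lambda>s. indicator {0..<t} s * (1 * s powr (p - 2)))
        (t powr (p - 1) * (1 / (p - 1)))" if "p \<ge> \<beta>" for p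
      using has_bochner_integral_powr[of "p - 2" t] assms that by simp
  qed (use assms in \<open>auto intro!: divide_left_mono\<close>)
  moreover have "x * rGamma (\<alpha> * real k + \<beta> - 1) * (1 / (\<alpha> * real k + \<beta> - 1)) =
      x * rGamma (\<alpha> * real k + \<beta>)" for k x
  proof -
    have "\<alpha> * real k + \<beta> - 1 > 0" using assms by (simp add: add_nonneg_pos add_diff_eq[symmetric])
    thus ?thesis using rGamma_plus1[of "\<alpha> * real k + \<beta> - 1"] by (simp add: field_simps)
  qed
  ultimately show ?thesis by (simp only: ml_fun_def[of \<alpha> \<beta>] mittag_leffler_def[of \<alpha> \<beta>] mult_1)
qed

section \<open>The derivative as a convolution with the logarithmic kernel\<close>

theorem theorem12:
  fixes \<alpha> \<beta> c t :: real
  assumes "\<alpha> > 0" and "\<beta> > 0" and "t \<ge> 0"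
  shows
    "(\<beta> > 1 \<longrightarrow>
        set_integrable lborel {0..t}
          (\<lambda>s. (ln (t - s) + euler_mascheroni) *
                 (s powr (\<beta> - 2) * mittag_leffler \<alpha> (\<beta> - 1) (c * s powr \<alpha>))) \<and>
        ((\<lambda>b. t powr (b - 1) * mittag_leffler \<alpha> b (c * t powr \<alpha>)) has_real_derivative
           (LBINT s:{0..t}. (ln (t - s) + euler_mascheroni) *
                 (s powr (\<beta> - 2) * mittag_leffler \<alpha> (\<beta> - 1) (c * s powr \<alpha>)))) (at \<beta>)) \<and>
     set_integrable lborel {0..t}
       (\<lambda>s. (log_kernel (t - s) - log_kernel (t - 0)) * ml_fun \<alpha> (\<beta> - 1) c s) \<and>
     ((\<lambda>b. t powr (b - 1) * mittag_leffler \<alpha> b (c * t powr \<alpha>)) has_real_derivative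
        ml_reg_integral \<alpha> \<beta> c t (\<lambda>s. log_kernel (t - s))) (at \<beta>)"
proof (cases "t = 0")
  case True
  \<comment> \<open>The function of \<open>b\<close> vanishes identically, as \<open>0 powr x = 0\<close>, and the integrals are over a
      null set.\<close>
  have "has_bochner_integral lborel (\<lambda>s. indicator {0..0} s * g s) 0" for g :: "real \<Rightarrow> real"
    using has_bochner_integral_half_open_iff[of 0 g 0] by (simp add: has_bochner_integral_zero)
  hence "set_integrable lborel {0..0} g" "set_lebesgue_integral lborel {0..0} g = 0" for g :: "real \<Rightarrow> real"
    unfolding set_integrable_def set_lebesgue_integral_def has_bochner_integral_iff real_scaleR_def by blast+
  with True show ?thesis
    by (simp add: ml_reg_integral_def ml_fun_def)
next
  case False
  with assms have t: "t > 0" by simp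
  define z where "z = c * t powr \<alpha>"
  define S where "S = (\<Sum>k. z ^ k * rGamma (\<alpha> * real k + \<beta> - 1) * digamma_quotient (\<alpha> * real k + \<beta>))"
  define F where "F = (ln t + euler_mascheroni) * ml_fun \<alpha> \<beta> c t - t powr (\<beta> - 1) * S"
  have deriv: "((\<lambda>b. t powr (b - 1) * mittag_leffler \<alpha> b (c * t powr \<alpha>)) has_real_derivative F) (at \<beta>)"
  proof -
    have "((\<lambda>b. t powr (b - 1)) has_real_derivative ln t * t powr (\<beta> - 1)) (at \<beta>)"
      using t by (auto intro!: derivative_eq_intros)
    from DERIV_mult[OF this mittag_leffler_has_derivative[OF assms(1,2), of z]]
    show ?thesis by (simp add: F_def S_def z_def ml_fun_def algebra_simps)
  qed
  have "has_bochner_integral lborel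
          (\<lambda>s. indicator {0..<t} s * ((ln t - ln (t - s)) * ml_fun \<alpha> (\<beta> - 1) c s)) (t powr (\<beta> - 1) * S)"
    unfolding S_def z_def
  proof (rule has_bochner_integral_weighted_ml_fun)
    show "\<bar>digamma_quotient p\<bar> \<le> digamma_quotient \<beta>" if "p \<ge> \<beta>" for p
      using assms that digamma_quotient_nonneg[of p] digamma_quotient_antimono[of \<beta> p] by simp
  qed (use assms t in \<open>auto intro!: has_bochner_integral_log_moment\<close>)
  from has_bochner_integral_minus[OF this]
  have log_part: "has_bochner_integral lborel
      (\<lambda>s. indicator {0..<t} s * ((ln (t - s) - ln t) * ml_fun \<alpha> (\<beta> - 1) c s)) (- (t powr (\<beta> - 1) * S))"
    by (simp add: algebra_simps)
  have reg: "set_integrable lborel {0..t}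
       (\<lambda>s. (log_kernel (t - s) - log_kernel (t - 0)) * ml_fun \<alpha> (\<beta> - 1) c s)"
    "ml_reg_integral \<alpha> \<beta> c t (\<lambda>s. log_kernel (t - s)) = F"
    using log_part unfolding has_bochner_integral_half_open_iff
    by (simp_all add: has_bochner_integral_iff set_integrable_def set_lebesgue_integral_def
          ml_reg_integral_def log_kernel_def F_def)
  \<comment> \<open>For \<open>\<beta> > 1\<close> the boundary term is itself an integral and is absorbed into the kernel.\<close>
  have "set_integrable lborel {0..t} (\<lambda>s. (ln (t - s) + euler_mascheroni) *
                 (s powr (\<beta> - 2) * mittag_leffler \<alpha> (\<beta> - 1) (c * s powr \<alpha>)))"
       "(LBINT s:{0..t}. (ln (t - s) + euler_mascheroni) *
                 (s powr (\<beta> - 2) * mittag_leffler \<alpha> (\<beta> - 1) (c * s powr \<alpha>))) = F"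
    if "\<beta> > 1"
  proof -
    have "has_bochner_integral lborel
      (\<lambda>s. indicator {0..<t} s * ((ln (t - s) - ln t) * ml_fun \<alpha> (\<beta> - 1) c s) +
           (ln t + euler_mascheroni) * (indicator {0..<t} s * ml_fun \<alpha> (\<beta> - 1) c s))
      (- (t powr (\<beta> - 1) * S) + (ln t + euler_mascheroni) * ml_fun \<alpha> \<beta> c t)"
      using assms that t
      by (intro has_bochner_integral_add log_part has_bochner_integral_mult_right has_bochner_integral_ml_fun) auto
    also have "(\<lambda>s. indicator {0..<t} s * ((ln (t - s) - ln t) * ml_fun \<alpha> (\<beta> - 1) c s) +
           (ln t + euler_mascheroni) * (indicator {0..<t} s * ml_fun \<alpha> (\<beta> - 1) c s)) =
       (\<lambda>s. indicator {0..<t} s * ((ln (t - s) + euler_mascheroni) * ml_fun \<alpha> (\<beta> - 1) c s))"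
      by (simp add: algebra_simps)
    finally have "has_bochner_integral lborel
       (\<lambda>s. indicator {0..t} s * ((ln (t - s) + euler_mascheroni) * ml_fun \<alpha> (\<beta> - 1) c s)) F"
      by (simp add: has_bochner_integral_half_open_iff F_def)
    thus "set_integrable lborel {0..t} (\<lambda>s. (ln (t - s) + euler_mascheroni) *
                 (s powr (\<beta> - 2) * mittag_leffler \<alpha> (\<beta> - 1) (c * s powr \<alpha>)))"
       "(LBINT s:{0..t}. (ln (t - s) + euler_mascheroni) *
                 (s powr (\<beta> - 2) * mittag_leffler \<alpha> (\<beta> - 1) (c * s powr \<alpha>))) = F"
      by (simp_all add: has_bochner_integral_iff set_integrable_def set_lebesgue_integral_def ml_fun_def)
  qed
  with reg deriv show ?thesis by simp
qed

end
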